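(* Let $H$ be a Hermitian operator on a finite-dimensional Hilbert space $\mathcal{H}$ with maximum eigenvalue $\delta_M$ and minimum eigenvalue $\delta_m<\delta_M$, with corresponding unit eigenvectors $|\delta_M\rangle$ and $|\delta_m\rangle$. Let $h=\sum_{1\le i<j<l\le 4}H_iH_jH_l$ on $\mathcal{H}^{\otimes 4}$, and for a unit vector $|\psi\rangle\in\mathcal{H}^{\otimes 4}$ let $F(\psi)=4\left(\langle\psi|h^2|\psi\rangle-\langle\psi|h|\psi\rangle^2\right)$. Let $|G\rangle=\left(|\delta_M\rangle^{\otimes 4}+|\delta_m\rangle^{\otimes 4}\right)/\sqrt{2}$. (1) If $\delta_M,\delta_m>0$, or $\delta_M,\delta_m<0$, then $F$ is maximized by $|G\rangle$. (2) If $\delta_M>0>\delta_m$ and $|\delta_M|>|\delta_m|$, then $F$ is maximized by $|G\rangle$ when $|\delta_M|<2|\delta_m|$, and by $|\delta_M\rangle^{\otimes 2}\otimes\left(|\delta_M\rangle^{\otimes 2}+|\delta_m\rangle^{\otimes 2}\right)/\sqrt{2}$, which is not genuinely multipartite entangled, when $|\delta_M|>2|\delta_m|$. (3) If $\delta_M>0>\delta_m$ and $|\delta_M|<|\delta_m|$, then $F$ is maximized by $|G\rangle$ when $|\delta_M|>|\delta_m|/2$, and by $|\delta_m\rangle^{\otimes 2}\otimes\left(|\delta_M\rangle^{\otimes 2}+|\delta_m\rangle^{\otimes 2}\right)/\sqrt{2}$, which is not genuinely multipartite entangled, when $|\delta_M|<|\delta_m|/2$. (4) If $\delta_M>0>\delta_m$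 and $|\delta_M|=|\delta_m|$, then $F$ is maximized by $|G\rangle$. Moreover, $|G\rangle$ is genuinely multipartite entangled.
   Context: $H_j$ denotes $H$ acting on the $j$-th tensor factor of $\mathcal{H}^{\otimes 4}$ and as the identity on the others. $F(\psi)$ is the quantum Fisher information for estimating $J$ in the encoding Hamiltonian $Jh$ with pure probe $|\psi\rangle$. A pure multipartite state is genuinely multipartite entangled iff for every bipartition of the parties into two nonempty sets the reduced density matrices are mixed (not pure). *)

theory Defs
  imports "HOL-Analysis.Analysis"
begin

text \<open>
  A finite-dimensional Hilbert space is \<open>complex ^ 'n\<close>. The tensor power over a finite set of
  parties \<open>'p\<close> has as its standard basis the assignments \<open>'p \<Rightarrow> 'n\<close> of a basis index to each
  party, so it is \<open>complex ^ ('p \<Rightarrow> 'n)\<close>. The numeral types \<open>4\<close> and \<open>2\<close> serve as party types;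
  their elements are \<open>0 < 1 < 2 < 3\<close> and \<open>0 < 1\<close>, so parties are counted from 0.
\<close>

definition hermitian :: "complex ^ 'n ^ 'n \<Rightarrow> bool" where
  "hermitian A \<longleftrightarrow> (\<chi> i j. cnj (A $ j $ i)) = A"

definition eigenvector :: "complex ^ 'n ^ 'n \<Rightarrow> complex ^ 'n \<Rightarrow> complex \<Rightarrow> bool" where
  "eigenvector A v c \<longleftrightarrow> v \<noteq> 0 \<and> A *v v = c *s v"

definition eigenvalue :: "complex ^ 'n ^ 'n \<Rightarrow> complex \<Rightarrow> bool" where
  "eigenvalue A c \<longleftrightarrow> (\<exists>v. eigenvector A v c)"

text \<open>The eigenvalues of a Hermitian matrix are real, so only real ones are compared.\<close>

definition max_eigenvalue :: "complex ^ 'n ^ 'n \<Rightarrow> real \<Rightarrow> bool" where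
  "max_eigenvalue A d \<longleftrightarrow> eigenvalue A (complex_of_real d) \<and>
     (\<forall>c. eigenvalue A (complex_of_real c) \<longrightarrow> c \<le> d)"

definition min_eigenvalue :: "complex ^ 'n ^ 'n \<Rightarrow> real \<Rightarrow> bool" where
  "min_eigenvalue A d \<longleftrightarrow> eigenvalue A (complex_of_real d) \<and>
     (\<forall>c. eigenvalue A (complex_of_real c) \<longrightarrow> d \<le> c)"

text \<open>The library's inner product on \<open>complex ^ 'n\<close> is real-valued (the real part of this one).\<close>

definition cinner :: "complex ^ 'n \<Rightarrow> complex ^ 'n \<Rightarrow> complex" where
  "cinner u v = (\<Sum>i\<in>UNIV. cnj (u $ i) * v $ i)"

definition expectation_value :: "complex ^ 'n ^ 'n \<Rightarrow> complex ^ 'n \<Rightarrow> complex" where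
  "expectation_value A \<psi> = cinner \<psi> (A *v \<psi>)"

text \<open>
  The quantum Fisher information of a pure probe. For Hermitian \<open>A\<close> both expectation values are
  real, so taking real parts only adjusts the type.
\<close>

definition fisher_info :: "complex ^ 'n ^ 'n \<Rightarrow> complex ^ 'n \<Rightarrow> real" where
  "fisher_info A \<psi> =
     4 * (Re (expectation_value (A ** A) \<psi>) - (Re (expectation_value A \<psi>))\<^sup>2)"

definition tensor_pow :: "complex ^ 'n \<Rightarrow> complex ^ ('p::finite \<Rightarrow> 'n::finite)" where
  "tensor_pow v = (\<chi> x. \<Prod>k\<in>UNIV. v $ x k)"

definition tensor_op :: "('p \<Rightarrow> complex ^ 'n ^ 'n) \<Rightarrow>
    complex ^ ('p::finite \<Rightarrow> 'n::finite) ^ ('p \<Rightarrow> 'n)" where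
  "tensor_op A = (\<chi> x y. \<Prod>k\<in>UNIV. A k $ x k $ y k)"

definition local_op :: "complex ^ 'n ^ 'n \<Rightarrow> 'p \<Rightarrow>
    complex ^ ('p::finite \<Rightarrow> 'n::finite) ^ ('p \<Rightarrow> 'n)" where
  "local_op A j = tensor_op (\<lambda>k. if k = j then A else mat 1)"

definition three_body :: "complex ^ 'n ^ 'n \<Rightarrow>
    complex ^ (4 \<Rightarrow> 'n::finite) ^ (4 \<Rightarrow> 'n)" where
  "three_body A = (\<Sum>(i, j, l) \<in> {(i, j, l). i < j \<and> j < l}.
     local_op A i ** local_op A j ** local_op A l)"

text \<open>The tensor product of two two-party vectors, the first one on the first two parties.\<close>

definition tensor22 :: "complex ^ (2 \<Rightarrow> 'n) \<Rightarrow> complex ^ (2 \<Rightarrow> 'n) \<Rightarrow>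
    complex ^ (4 \<Rightarrow> 'n::finite)" where
  "tensor22 \<phi> \<psi> = (\<chi> x. \<phi> $ (\<lambda>k. if k = 0 then x 0 else x 1) *
                        \<psi> $ (\<lambda>k. if k = 0 then x 2 else x 3))"

text \<open>
  The standard basis of the Hilbert space of a set \<open>S\<close> of parties. A vector of that space is a
  function on this basis, and an operator on it is a function of two basis elements.
\<close>

definition local_basis :: "'p set \<Rightarrow> ('p \<Rightarrow> 'n) set" where
  "local_basis S = (S \<rightarrow>\<^sub>E UNIV)"

text \<open>
  The matrix elements, between \<open>a\<close> and \<open>b\<close> in \<open>local_basis S\<close>, of the partial trace of
  \<open>|\<psi>><\<psi>|\<close> over the complement of \<open>S\<close>.
\<close>

definition reduced_density :: "complex ^ ('p \<Rightarrow> 'n) \<Rightarrow> 'p set \<Rightarrow>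
    ('p::finite \<Rightarrow> 'n::finite) \<Rightarrow> ('p \<Rightarrow> 'n) \<Rightarrow> complex" where
  "reduced_density \<psi> S a b = (\<Sum>c\<in>local_basis (- S).
     \<psi> $ (\<lambda>k. if k \<in> S then a k else c k) *
     cnj (\<psi> $ (\<lambda>k. if k \<in> S then b k else c k)))"

definition pure_density :: "'p set \<Rightarrow>
    (('p::finite \<Rightarrow> 'n::finite) \<Rightarrow> ('p \<Rightarrow> 'n) \<Rightarrow> complex) \<Rightarrow> bool" where
  "pure_density S \<rho> \<longleftrightarrow> (\<exists>\<phi> :: ('p \<Rightarrow> 'n) \<Rightarrow> complex.
     (\<Sum>a\<in>local_basis S. (cmod (\<phi> a))\<^sup>2) = 1 \<and>
     (\<forall>a\<in>local_basis S. \<forall>b\<in>local_basis S. \<rho> a b = \<phi> a * cnj (\<phi> b)))"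

text \<open>
  A bipartition is \<open>{S, - S}\<close>; both of its reduced density matrices are covered because \<open>S\<close> ranges
  over all nonempty proper subsets.
\<close>

definition genuinely_multipartite_entangled ::
    "complex ^ ('p::finite \<Rightarrow> 'n::finite) \<Rightarrow> bool" where
  "genuinely_multipartite_entangled \<psi> \<longleftrightarrow>
     (\<forall>S. S \<noteq> {} \<and> S \<noteq> UNIV \<longrightarrow> \<not> pure_density S (reduced_density \<psi> S))"

definition ghz_state :: "complex ^ 'n \<Rightarrow> complex ^ 'n \<Rightarrow> complex ^ (4 \<Rightarrow> 'n::finite)" where
  "ghz_state u v = (tensor_pow u + tensor_pow v) /\<^sub>R sqrt 2"

definition product_state :: "complex ^ 'n \<Rightarrow> complex ^ 'n \<Rightarrow> complex ^ 'n \<Rightarrow>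
    complex ^ (4 \<Rightarrow> 'n::finite)" where
  "product_state w u v = tensor22 (tensor_pow w) ((tensor_pow u + tensor_pow v) /\<^sub>R sqrt 2)"

definition maximized_by :: "(complex ^ 'n \<Rightarrow> real) \<Rightarrow> complex ^ 'n \<Rightarrow> bool" where
  "maximized_by F \<psi> \<longleftrightarrow> is_arg_max F (\<lambda>\<phi>. norm \<phi> = 1) \<psi>"

end

theory Submission
  imports Defs
begin

text \<open>
  Let \<open>B\<close> be an orthonormal eigenbasis of \<open>H\<close>. The product vectors over \<open>B\<close> resolve the identity and
  are eigenvectors of \<open>h\<close>, with eigenvalue the third elementary symmetric polynomial of the four
  eigenvalues of \<open>H\<close> involved. Hence \<open>F \<psi>\<close> is four times the variance of a random variable with values
  in the range of that polynomial on the cube \<open>[\<delta>m, \<delta>M]^4\<close>, so it is at most the square of the length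
  of this range, and the bound is attained by an equal superposition of two eigenvectors of \<open>h\<close> for
  the extreme values. The polynomial is affine in each variable, so its extrema are among its five
  values at the vertices; which ones is decided by factorisations such as
  \<open>M^3 + 3 M^2 m - 4 m^3 = (M - m) (M + 2 m)^2\<close>.
\<close>

section \<open>Spectral decomposition of Hermitian matrices\<close>

text \<open>For small negative \<open>t\<close> a nonzero linear term would dominate:
  \<open>t = - n / q\<close> gives the value \<open>- n\<^sup>2 / q\<close>, and if
  \<open>q = 0\<close> already \<open>t = -1\<close> is negative.\<close>

lemma nonneg_quadratic_linear_coeff:
  fixes n q :: real
  assumes Q: "\<And>t. 0 \<le> 2 * t * n + t\<^sup>2 * q" and "0 \<le> n" "0 \<le> q"
  shows "n = 0"
proof (rule ccontr)
  assume "n \<noteq> 0"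
  with \<open>0 \<le> n\<close> have n: "0 < n" by simp
  show False
  proof (cases "q = 0")
    case True
    then show False using Q[of "-1"] n by simp
  next
    case False
    then show False
      using Q[of "- n / q"] n mult_pos_pos[OF n n] \<open>0 \<le> q\<close>
      by (simp add: power2_eq_square field_simps)
  qed
qed

text \<open>A maximizer of the Rayleigh quotient on the compact unit sphere of \<open>W\<close> is
  an eigenvector. The real setting is enough: a complex Hermitian matrix is selfadjoint for the real
  part of \<open>cinner\<close>, and its eigenvalues are real.\<close>

lemma selfadjoint_eigenvector_in_subspace:
  fixes f :: "'a::euclidean_space \<Rightarrow> 'a"
  assumes f: "linear f" and sym: "\<And>x y. f x \<bullet> y = x \<bullet> f y"
    and W: "subspace W" and inv: "\<And>x. x \<in> W \<Longrightarrow> f x \<in> W" and w: "w \<in> W" "w \<noteq> 0"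
  shows "\<exists>v\<in>W. \<exists>c. norm v = 1 \<and> f v = c *\<^sub>R v"
proof -
  let ?K = "sphere 0 1 \<inter> W"
  have "compact ?K"
    using W by (simp add: compact_Int_closed closed_subspace)
  moreover have "w /\<^sub>R norm w \<in> ?K"
    using w W by (simp add: subspace_scale)
  then have "?K \<noteq> {}" by blast
  moreover have "continuous_on ?K (\<lambda>x. x \<bullet> f x)"
    using f by (intro continuous_on_inner continuous_on_id linear_continuous_on)
      (simp add: linear_conv_bounded_linear)
  ultimately obtain v where v: "v \<in> ?K" and max: "\<And>x. x \<in> ?K \<Longrightarrow> x \<bullet> f x \<le> v \<bullet> f v"
    by (metis (no_types, lifting) continuous_attains_sup)
  \<comment> \<open>\<open>A\<close> is positive semidefinite on \<open>W\<close> and \<open>v \<bullet> A v = 0\<close>, so \<open>A v = 0\<close> by varying \<open>v\<close> along \<open>A v\<close>.\<close>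
  define c where "c = v \<bullet> f v"
  define A where "A x = c *\<^sub>R x - f x" for x
  have vv: "v \<bullet> v = 1" "v \<in> W" using v by (auto simp: norm_eq_1)
  have pos: "0 \<le> x \<bullet> A x" if "x \<in> W" for x
  proof (cases "x = 0")
    case False
    have "x /\<^sub>R norm x \<in> ?K" using False that W by (simp add: subspace_scale)
    from max[OF this] have "(x \<bullet> f x) / (norm x)\<^sup>2 \<le> c"
      using f by (simp add: c_def linear_scale power2_eq_square divide_inverse mult_ac)
    then show ?thesis
      using False by (simp add: A_def inner_diff_right field_simps power2_norm_eq_inner)
  qed (simp add: A_def)
  define g where "g = A v"
  have gW: "g \<in> W"
    using vv W inv by (simp add: g_def A_def subspace_diff subspace_scale)
  have symA: "x \<bullet> A y = A x \<bullet> y" for x y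
    by (simp add: A_def sym inner_diff_left inner_diff_right)
  have Aadd: "A (x + y) = A x + A y" and Asc: "A (t *\<^sub>R x) = t *\<^sub>R A x" for x y t
    using f by (simp_all add: A_def linear_add linear_scale algebra_simps)
  have Q: "0 \<le> 2 * t * (g \<bullet> g) + t\<^sup>2 * (g \<bullet> A g)" for t
  proof -
    have "0 \<le> (v + t *\<^sub>R g) \<bullet> A (v + t *\<^sub>R g)"
      using vv gW W by (intro pos) (simp add: subspace_add subspace_scale)
    moreover have "v \<bullet> A v = 0" by (simp add: A_def inner_diff_right vv c_def)
    moreover have "v \<bullet> A g = g \<bullet> g" by (simp add: symA g_def)
    ultimately show ?thesis
      by (simp add: Aadd Asc inner_add_left inner_add_right power2_eq_square g_def algebra_simps)
  qed
  have "g \<bullet> g = 0"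
    using Q pos[OF gW] by (intro nonneg_quadratic_linear_coeff) auto
  then have "f v = c *\<^sub>R v" by (simp add: g_def A_def)
  then show ?thesis using v by auto
qed

section \<open>The complex inner product\<close>

lemma cinner_add_left: "cinner (u + v) w = cinner u w + cinner v w"
  by (simp add: cinner_def algebra_simps sum.distrib)

lemma cinner_add_right: "cinner w (u + v) = cinner w u + cinner w v"
  by (simp add: cinner_def algebra_simps sum.distrib)

lemma cinner_diff_right: "cinner w (u - v) = cinner w u - cinner w v"
  by (simp add: cinner_def algebra_simps sum_subtractf)

lemma cinner_scale_left: "cinner (c *s u) v = cnj c * cinner u v"
  by (simp add: cinner_def sum_distrib_left mult_ac)

lemma cinner_scale_right: "cinner u (c *s v) = c * cinner u v"
  by (simp add: cinner_def sum_distrib_left mult_ac)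

lemma cinner_scaleR_left: "cinner (r *\<^sub>R u) v = r *\<^sub>R cinner u v"
  by (simp add: cinner_def scaleR_sum_right)

lemma cinner_scaleR_right: "cinner u (r *\<^sub>R v) = r *\<^sub>R cinner u v"
  by (simp add: cinner_def scaleR_sum_right)

lemma cinner_zero_right: "cinner u 0 = 0"
  by (simp add: cinner_def)

lemma cinner_sum_right: "cinner w (\<Sum>x\<in>X. f x) = (\<Sum>x\<in>X. cinner w (f x))"
  by (induction X rule: infinite_finite_induct) (simp_all add: cinner_add_right cinner_zero_right)

lemma cinner_commute: "cinner v u = cnj (cinner u v)"
  by (simp add: cinner_def mult_ac)

lemma Re_cinner: "Re (cinner u v) = u \<bullet> v"
  by (simp add: cinner_def inner_vec_def inner_complex_def)

lemma cinner_self: "cinner v v = complex_of_real ((norm v)\<^sup>2)"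
  by (rule complex_eqI)
    (simp_all add: Re_cinner power2_norm_eq_inner, simp add: cinner_def)

lemma cinner_self_eq_1_iff: "cinner v v = 1 \<longleftrightarrow> norm v = 1"
  using norm_ge_zero[of v] unfolding cinner_self of_real_eq_1_iff power2_eq_1_iff by linarith

lemma hermitian_cinner:
  assumes "hermitian A"
  shows "cinner u (A *v w) = cinner (A *v u) w"
proof -
  have A: "cnj (A $ j $ i) = A $ i $ j" for i j
    using assms unfolding hermitian_def by (metis vec_lambda_beta)
  have "cinner u (A *v w) = (\<Sum>i\<in>UNIV. \<Sum>j\<in>UNIV. cnj (u $ i) * A $ i $ j * w $ j)"
    by (simp add: cinner_def matrix_vector_mult_def sum_distrib_left mult.assoc)
  also have "\<dots> = (\<Sum>j\<in>UNIV. \<Sum>i\<in>UNIV. cnj (u $ i) * A $ i $ j * w $ j)"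
    by (rule sum.swap)
  also have "\<dots> = cinner (A *v u) w"
    by (simp add: cinner_def matrix_vector_mult_def sum_distrib_left A mult_ac)
  finally show ?thesis .
qed

lemma matrix_vector_scaleR: "(A :: complex ^ 'n ^ 'm) *v (r *\<^sub>R v) = r *\<^sub>R (A *v v)"
  by (simp add: vec_eq_iff matrix_vector_mult_def scaleR_sum_right)

lemma scale_of_real: "complex_of_real c *s v = c *\<^sub>R v"
  by (simp add: vec_eq_iff scaleR_conv_of_real[symmetric])

section \<open>Orthonormal eigenbases\<close>

definition orthonormal_eigenvectors :: "complex ^ 'n ^ 'n \<Rightarrow> (complex ^ 'n::finite) set \<Rightarrow> bool" where
  "orthonormal_eigenvectors H B \<longleftrightarrow>
     (\<forall>b\<in>B. norm b = 1 \<and> (\<exists>c. H *v b = complex_of_real c *s b)) \<and>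
     (\<forall>b\<in>B. \<forall>b'\<in>B. b \<noteq> b' \<longrightarrow> cinner b b' = 0)"

text \<open>Orthogonality for \<open>cinner\<close> implies real orthogonality, hence real
  independence. The bound is the real dimension, twice the complex one; it serves only to make a set
  of maximal cardinality exist.\<close>

lemma orthonormal_eigenvectors_card:
  fixes B :: "(complex ^ 'n::finite) set"
  assumes "orthonormal_eigenvectors H B"
  shows "finite B \<and> card B \<le> DIM(complex ^ 'n)"
proof -
  have "pairwise orthogonal B" "0 \<notin> B"
    using assms by (auto simp: orthonormal_eigenvectors_def pairwise_def orthogonal_def
        simp flip: Re_cinner)
  then show ?thesis
    using pairwise_orthogonal_independent independent_bound by blast
qed

text \<open>Completeness is expressed entrywise as a resolution of the identity, because in this
  form it multiplies over the tensor factors.\<close>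

lemma hermitian_eigenbasis:
  fixes H :: "complex ^ 'n ^ 'n::finite"
  assumes H: "hermitian H"
  obtains B where "finite B" "orthonormal_eigenvectors H B"
    "\<And>i j. (\<Sum>b\<in>B. b $ i * cnj (b $ j)) = of_bool (i = j)"
proof -
  have "orthonormal_eigenvectors H {}" by (simp add: orthonormal_eigenvectors_def)
  then obtain B where B: "orthonormal_eigenvectors H B"
    and max: "\<And>C. orthonormal_eigenvectors H C \<Longrightarrow> card C \<le> card B"
    using ex_has_greatest_nat[of "orthonormal_eigenvectors H" "{}" card "Suc (DIM(complex ^ 'n))"]
      orthonormal_eigenvectors_card[of H] by (auto simp: less_Suc_eq_le)
  have fin: "finite B" using B orthonormal_eigenvectors_card by blast
  \<comment> \<open>By maximality of \<open>B\<close>, its invariant orthogonal complement \<open>W\<close> has no eigenvector, so it is zero.\<close>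
  define W where "W = {v. \<forall>b\<in>B. cinner b v = 0}"
  have W0: "w = 0" if "w \<in> W" for w
  proof (rule ccontr)
    assume w0: "w \<noteq> 0"
    have sub: "subspace W"
      by (auto simp: W_def subspace_def cinner_zero_right cinner_add_right cinner_scaleR_right)
    have inv: "H *v x \<in> W" if x: "x \<in> W" for x
    proof -
      have "cinner b (H *v x) = 0" if b: "b \<in> B" for b
      proof -
        obtain c where "H *v b = complex_of_real c *s b"
          using B b unfolding orthonormal_eigenvectors_def by blast
        then show ?thesis
          using x b by (simp add: hermitian_cinner[OF H] cinner_scale_left W_def)
      qed
      then show ?thesis by (simp add: W_def)
    qed
    have lin: "linear ((*v) H)"
      by (intro linearI matrix_vector_right_distrib matrix_vector_scaleR)
    have sym: "(H *v x) \<bullet> y = x \<bullet> (H *v y)" for x y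
      by (simp add: hermitian_cinner[OF H] flip: Re_cinner)
    obtain v c where v: "v \<in> W" "norm v = 1" "H *v v = c *\<^sub>R v"
      using selfadjoint_eigenvector_in_subspace[OF lin sym sub inv \<open>w \<in> W\<close> w0] by blast
    have "v \<notin> B"
      using v by (auto simp: W_def cinner_self)
    moreover have "orthonormal_eigenvectors H (insert v B)"
      using B v unfolding orthonormal_eigenvectors_def W_def
      by (auto simp: scale_of_real) (metis cinner_commute complex_cnj_zero)
    ultimately show False using max[of "insert v B"] fin by simp
  qed
  have expand: "v = (\<Sum>b\<in>B. cinner b v *s b)" for v
  proof -
    have "cinner b (\<Sum>b'\<in>B. cinner b' v *s b') = cinner b v" if "b \<in> B" for b
    proof -
      have "cinner b (\<Sum>b'\<in>B. cinner b' v *s b') = (\<Sum>b'\<in>B. cinner b' v * cinner b b')"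
        by (simp add: cinner_sum_right cinner_scale_right)
      also have "\<dots> = (\<Sum>b'\<in>B. if b' = b then cinner b v else 0)"
        using B that by (intro sum.cong) (auto simp: orthonormal_eigenvectors_def cinner_self)
      finally show ?thesis using that fin by simp
    qed
    then have "v - (\<Sum>b\<in>B. cinner b v *s b) \<in> W"
      by (simp add: W_def cinner_diff_right)
    then show ?thesis using W0 by fastforce
  qed
  have "(\<Sum>b\<in>B. b $ i * cnj (b $ j)) = of_bool (i = j)" for i j
  proof -
    \<comment> \<open>Coordinate \<open>i\<close> of the expansion of the \<open>j\<close>-th
      standard basis vector is the required identity.\<close>
    have c: "cinner b (axis j 1) = cnj (b $ j)" for b
      by (simp add: cinner_def axis_def if_distrib cong: if_cong)
    have "axis j 1 $ i = (\<Sum>b\<in>B. cnj (b $ j) * b $ i)"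
      by (subst expand) (simp add: c)
    then show ?thesis by (simp add: axis_def mult.commute split: if_splits)
  qed
  then show thesis using that fin B by blast
qed

section \<open>Fisher information\<close>

lemma eigenvectors_orthogonal:
  assumes "hermitian A" "A *v u = complex_of_real a *s u" "A *v v = complex_of_real b *s v" "a \<noteq> b"
  shows "cinner u v = 0"
proof -
  have "complex_of_real b * cinner u v = cinner u (A *v v)"
    by (simp only: assms(3) cinner_scale_right)
  also have "\<dots> = complex_of_real a * cinner u v"
    by (simp only: hermitian_cinner[OF assms(1)] assms(2) cinner_scale_left complex_cnj_complex_of_real)
  finally show ?thesis using \<open>a \<noteq> b\<close> by simp
qed

text \<open>Popoviciu's bound on a variance: the weights
  \<open>(cmod (cinner (u x) \<psi>))\<^sup>2\<close> form a probability distribution on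
  \<open>X\<close>, under which \<open>a\<close> has the first two moments of \<open>A\<close>. By
  \<open>eig\<close> each \<open>u x\<close> is a left eigenvector, so both moments come from
  Parseval's identity.\<close>

lemma fisher_info_le:
  fixes A :: "complex ^ 'n ^ 'n::finite"
  assumes eig: "\<And>x \<psi>. x \<in> X \<Longrightarrow> cinner (u x) (A *v \<psi>) = complex_of_real (a x) * cinner (u x) \<psi>"
    and resolution: "\<And>i j. (\<Sum>x\<in>X. u x $ i * cnj (u x $ j)) = of_bool (i = j)"
    and bounds: "\<And>x. x \<in> X \<Longrightarrow> lo \<le> a x \<and> a x \<le> hi"
    and \<psi>: "norm \<psi> = 1"
  shows "fisher_info A \<psi> \<le> (hi - lo)\<^sup>2"
proof -
  define p where "p x = (cmod (cinner (u x) \<psi>))\<^sup>2" for x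
  have parseval: "cinner v w = (\<Sum>x\<in>X. cnj (cinner (u x) v) * cinner (u x) w)" for v w
  proof -
    have "(\<Sum>x\<in>X. cnj (cinner (u x) v) * cinner (u x) w) =
        (\<Sum>x\<in>X. \<Sum>i\<in>UNIV. \<Sum>j\<in>UNIV. cnj (v $ i) * w $ j * (u x $ i * cnj (u x $ j)))"
      unfolding cinner_def cnj_sum sum_product by (simp add: mult_ac)
    also have "\<dots> = (\<Sum>i\<in>UNIV. \<Sum>x\<in>X. \<Sum>j\<in>UNIV. cnj (v $ i) * w $ j * (u x $ i * cnj (u x $ j)))"
      by (rule sum.swap)
    also have "\<dots> = (\<Sum>i\<in>UNIV. \<Sum>j\<in>UNIV. cnj (v $ i) * w $ j * (\<Sum>x\<in>X. u x $ i * cnj (u x $ j)))"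
      unfolding sum_distrib_left by (intro sum.cong refl sum.swap)
    also have "\<dots> = cinner v w"
      by (simp add: resolution cinner_def of_bool_def if_distrib cong: if_cong)
    finally show ?thesis by simp
  qed
  have pp: "cnj (cinner (u x) \<psi>) * cinner (u x) \<psi> = complex_of_real (p x)" for x
    by (metis p_def complex_norm_square mult.commute)
  have sum_p: "(\<Sum>x\<in>X. p x) = 1"
  proof -
    have "complex_of_real (\<Sum>x\<in>X. p x) = cinner \<psi> \<psi>"
      by (simp add: parseval[of \<psi> \<psi>] pp)
    then show ?thesis using \<psi> by (simp add: cinner_self flip: of_real_sum)
  qed
  have "expectation_value A \<psi> = (\<Sum>x\<in>X. complex_of_real (a x) * (cnj (cinner (u x) \<psi>) * cinner (u x) \<psi>))"
    unfolding expectation_value_def parseval[of \<psi> "A *v \<psi>"]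
    by (intro sum.cong) (simp_all add: eig)
  then have E1: "Re (expectation_value A \<psi>) = (\<Sum>x\<in>X. a x * p x)"
    by (simp add: pp)
  have "expectation_value (A ** A) \<psi> =
      (\<Sum>x\<in>X. complex_of_real ((a x)\<^sup>2) * (cnj (cinner (u x) \<psi>) * cinner (u x) \<psi>))"
    unfolding expectation_value_def parseval[of \<psi> "(A ** A) *v \<psi>"]
    by (intro sum.cong) (simp_all add: eig power2_eq_square flip: matrix_vector_mul_assoc)
  then have E2: "Re (expectation_value (A ** A) \<psi>) = (\<Sum>x\<in>X. (a x)\<^sup>2 * p x)"
    by (simp add: pp del: of_real_power)
  \<comment> \<open>Averaging \<open>(hi - a x) * (a x - lo)\<close> bounds the second moment by an
    affine function of the mean.\<close>
  have "0 \<le> (\<Sum>x\<in>X. ((hi - a x) * (a x - lo)) * p x)"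
    using bounds by (intro sum_nonneg) (simp add: p_def)
  also have "\<dots> = (hi + lo) * (\<Sum>x\<in>X. a x * p x) - (\<Sum>x\<in>X. (a x)\<^sup>2 * p x) - hi * lo * (\<Sum>x\<in>X. p x)"
    by (simp add: sum_distrib_left sum_subtractf[symmetric] power2_eq_square algebra_simps)
  finally have "(\<Sum>x\<in>X. (a x)\<^sup>2 * p x) \<le> (hi + lo) * (\<Sum>x\<in>X. a x * p x) - hi * lo"
    by (simp add: sum_p)
  \<comment> \<open>The difference of the two sides is the square of
    \<open>2 * e - (hi + lo)\<close>; the worst mean is the midpoint.\<close>
  moreover have "4 * ((hi + lo) * e - hi * lo - e\<^sup>2) \<le> (hi - lo)\<^sup>2" for e
    using zero_le_power2[of "2 * e - (hi + lo)"] by (simp add: power2_eq_square algebra_simps)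
  ultimately show ?thesis
    unfolding fisher_info_def E1 E2 by (smt (verit))
qed

text \<open>The equality case of \<open>fisher_info_le\<close>: the values \<open>a\<close> and
  \<open>b\<close> each occur with probability 1/2.\<close>

lemma superposition:
  assumes "norm p = 1" "norm q = 1" "cinner p q = 0"
    and A: "A *v p = complex_of_real a *s p" "A *v q = complex_of_real b *s q"
  shows norm_superposition: "norm ((p + q) /\<^sub>R sqrt 2) = 1"
    and fisher_info_superposition: "fisher_info A ((p + q) /\<^sub>R sqrt 2) = (a - b)\<^sup>2"
proof -
  define s where "s = (p + q) /\<^sub>R sqrt 2"
  have pq: "cinner p p = 1" "cinner q q = 1" "cinner p q = 0" "cinner q p = 0"
    using assms by (simp_all add: cinner_self_eq_1_iff cinner_commute[of q p])
  \<comment> \<open>General coefficients allow a second application of \<open>A\<close>, as needed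
    for \<open>A ** A\<close>.\<close>
  have A_s: "A *v ((c *s p + d *s q) /\<^sub>R sqrt 2) =
      ((complex_of_real a * c) *s p + (complex_of_real b * d) *s q) /\<^sub>R sqrt 2" for c d
    by (simp add: matrix_vector_scaleR matrix_vector_right_distrib vector_scalar_commute A mult.commute)
  have As: "A *v s = (complex_of_real a *s p + complex_of_real b *s q) /\<^sub>R sqrt 2"
    using A_s[of 1 1] by (simp add: s_def)
  have c: "cinner s ((c *s p + d *s q) /\<^sub>R sqrt 2) = (c + d) / 2" for c d
  proof -
    have "cinner s ((c *s p + d *s q) /\<^sub>R sqrt 2) = (c + d) /\<^sub>R sqrt 2 /\<^sub>R sqrt 2"
      by (simp only: s_def cinner_scaleR_left cinner_scaleR_right)
        (simp add: cinner_add_left cinner_add_right cinner_scale_right pq)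
    then show ?thesis by (simp add: complex_eq_iff field_simps)
  qed
  have "cinner s s = 1" using c[of 1 1] by (simp add: s_def)
  then have "norm s = 1" by (simp only: cinner_self_eq_1_iff)
  then show "norm ((p + q) /\<^sub>R sqrt 2) = 1" by (simp add: s_def)
  have E: "Re (expectation_value A s) = (a + b) / 2"
    by (simp add: expectation_value_def As c)
  have E2: "Re (expectation_value (A ** A) s) = (a\<^sup>2 + b\<^sup>2) / 2"
    by (simp add: expectation_value_def As A_s c power2_eq_square flip: matrix_vector_mul_assoc)
  show "fisher_info A ((p + q) /\<^sub>R sqrt 2) = (a - b)\<^sup>2"
    unfolding fisher_info_def s_def[symmetric] E E2
    by (simp add: power2_eq_square field_simps)
qed

section \<open>Tensor products\<close>

lemma sum_prod_PiE_UNIV: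
  fixes h :: "'p::finite \<Rightarrow> 'b \<Rightarrow> 'c::comm_semiring_1"
  assumes "finite B"
  shows "(\<Sum>x\<in>UNIV \<rightarrow>\<^sub>E B. \<Prod>k\<in>UNIV. h k (x k)) = (\<Prod>k\<in>UNIV. \<Sum>i\<in>B. h k i)"
  using prod_sum_PiE[of UNIV "\<lambda>_. B" h] assms by simp

lemma sum_prod_UNIV:
  fixes h :: "'p::finite \<Rightarrow> 'n::finite \<Rightarrow> 'c::comm_semiring_1"
  shows "(\<Sum>x\<in>UNIV. \<Prod>k\<in>UNIV. h k (x k)) = (\<Prod>k\<in>UNIV. \<Sum>i\<in>UNIV. h k i)"
  using sum_prod_PiE_UNIV[of UNIV h] by (simp add: PiE_UNIV_domain)

text \<open>Different factors are allowed, so that products of eigenbasis vectors, tensor powers and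
  both terms of the product state are all instances.\<close>

definition tensor_vec :: "('p \<Rightarrow> complex ^ 'n) \<Rightarrow> complex ^ ('p::finite \<Rightarrow> 'n::finite)" where
  "tensor_vec f = (\<chi> x. \<Prod>k\<in>UNIV. f k $ x k)"

lemma tensor_op_tensor_vec: "tensor_op A *v tensor_vec f = tensor_vec (\<lambda>k. A k *v f k)"
proof -
  have "(\<Sum>y\<in>UNIV. \<Prod>k\<in>UNIV. A k $ x k $ y k * f k $ y k) =
      (\<Prod>k\<in>UNIV. \<Sum>j\<in>UNIV. A k $ x k $ j * f k $ j)" for x
    by (rule sum_prod_UNIV)
  then show ?thesis
    by (simp add: vec_eq_iff matrix_vector_mult_def tensor_op_def tensor_vec_def flip: prod.distrib)
qed

lemma cinner_tensor_vec: "cinner (tensor_vec f) (tensor_vec g) = (\<Prod>k\<in>UNIV. cinner (f k) (g k))"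
  by (simp add: cinner_def tensor_vec_def sum_prod_UNIV[of "\<lambda>k i. cnj (f k $ i) * g k $ i"]
      flip: prod.distrib)

lemma norm_tensor_vec:
  assumes "\<And>k. norm (f k) = 1"
  shows "norm (tensor_vec f) = 1"
proof -
  have "cinner (tensor_vec f) (tensor_vec f) = 1"
    using assms by (simp add: cinner_tensor_vec flip: cinner_self_eq_1_iff)
  then show ?thesis by (simp only: cinner_self_eq_1_iff)
qed

lemma tensor_vec_scale: "tensor_vec (\<lambda>k. c k *s f k) = (\<Prod>k\<in>UNIV. c k) *s tensor_vec f"
  by (simp add: vec_eq_iff tensor_vec_def prod.distrib)

lemma local_op_tensor_vec:
  assumes "A *v f j = c *s f j"
  shows "local_op A j *v tensor_vec f = c *s tensor_vec f"
proof -
  have "local_op A j *v tensor_vec f = tensor_vec (\<lambda>k. (if k = j then c else 1) *s f k)"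
    unfolding local_op_def tensor_op_tensor_vec
    by (rule arg_cong[of _ _ tensor_vec]) (auto simp: assms)
  then show ?thesis by (simp add: tensor_vec_scale)
qed

lemma hermitian_local_op:
  assumes "hermitian A"
  shows "hermitian (local_op A j)"
proof -
  have "cnj (A $ k $ i) = A $ i $ k" for i k
    using assms unfolding hermitian_def by (metis vec_lambda_beta)
  then show ?thesis
    by (auto simp: hermitian_def local_op_def tensor_op_def vec_eq_iff mat_def intro!: prod.cong)
qed

text \<open>The sum over families factorizes into one resolution of the identity per party.\<close>

lemma tensor_resolution:
  fixes B :: "(complex ^ 'n::finite) set" and x y :: "'p::finite \<Rightarrow> 'n"
  assumes "finite B" and B: "\<And>i j. (\<Sum>b\<in>B. b $ i * cnj (b $ j)) = of_bool (i = j)"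
  shows "(\<Sum>f\<in>UNIV \<rightarrow>\<^sub>E B. tensor_vec f $ x * cnj (tensor_vec f $ y)) = of_bool (x = y)"
proof -
  have "(\<Sum>f\<in>UNIV \<rightarrow>\<^sub>E B. tensor_vec f $ x * cnj (tensor_vec f $ y)) =
      (\<Prod>k\<in>UNIV. \<Sum>b\<in>B. b $ x k * cnj (b $ y k))"
    using sum_prod_PiE_UNIV[OF assms(1), of "\<lambda>k b. b $ x k * cnj (b $ y k)"]
    by (simp add: tensor_vec_def prod.distrib)
  then show ?thesis by (auto simp: B fun_eq_iff)
qed

text \<open>In the numeral type \<open>4\<close>, the numeral \<open>4\<close> denotes \<open>0\<close>.\<close>

lemma UNIV_4_zero: "(UNIV :: 4 set) = {0, 1, 2, 3}"
  using UNIV_4 by auto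

lemma less_4:
  "(0::4) < 1" "(0::4) < 2" "(0::4) < 3" "(1::4) < 2" "(1::4) < 3" "(2::4) < 3"
  by (simp_all add: less_bit0_def bit0.Rep_0 bit0.Rep_1 bit0.Rep_numeral)

lemma neq_4:
  "(0::4) \<noteq> 1" "(0::4) \<noteq> 2" "(0::4) \<noteq> 3" "(1::4) \<noteq> 2" "(1::4) \<noteq> 3" "(2::4) \<noteq> 3"
  "(1::4) \<noteq> 0" "(2::4) \<noteq> 0" "(3::4) \<noteq> 0" "(2::4) \<noteq> 1" "(3::4) \<noteq> 1" "(3::4) \<noteq> 2"
  by (simp_all only: less_4[THEN less_imp_neq] less_4[THEN less_imp_neq, THEN not_sym] simp_thms)

lemma prod_UNIV_4: "(\<Prod>k\<in>UNIV. f k) = f 0 * (f 1 * (f 2 * f (3 :: 4)))"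
  by (simp only: UNIV_4_zero) (simp add: neq_4)

lemma compl_01_4: "- {0, 1 :: 4} = {2, 3}"
proof (rule set_eqI)
  fix i :: 4
  have "i = 0 \<or> i = 1 \<or> i = 2 \<or> i = 3"
    using UNIV_4_zero by blast
  then show "i \<in> - {0, 1} \<longleftrightarrow> i \<in> {2, 3}"
    by (elim disjE) (simp_all add: neq_4)
qed

lemma increasing_triples_4:
  "{(i, j, l :: 4). i < j \<and> j < l} = {(0, 1, 2), (0, 1, 3), (0, 2, 3), (1, 2, 3)}"
proof -
  note less = less_4 less_4[THEN less_not_sym] less_4[THEN less_imp_neq] less_4[THEN less_imp_neq, symmetric]
  have mem: "i = 0 \<or> i = 1 \<or> i = 2 \<or> i = 3" for i :: 4 using UNIV_4_zero by blast
  have "i < j \<and> j < l \<longleftrightarrow> (i, j, l) \<in> {(0, 1, 2), (0, 1, 3), (0, 2, 3), (1, 2, 3)}" for i j l :: 4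
    using mem[of i] mem[of j] mem[of l] by (elim disjE) (simp_all add: less)
  then show ?thesis by auto
qed

section \<open>The three-body Hamiltonian on product eigenvectors\<close>

lemma three_body_expand:
  "three_body A = local_op A 0 ** local_op A 1 ** local_op A 2 +
     local_op A 0 ** local_op A 1 ** local_op A 3 +
     local_op A 0 ** local_op A 2 ** local_op A 3 +
     local_op A 1 ** local_op A 2 ** local_op A 3"
  using less_4[THEN less_imp_neq] unfolding three_body_def increasing_triples_4 by (simp add: add.assoc)

definition esym3 :: "(4 \<Rightarrow> real) \<Rightarrow> real" where
  "esym3 a = a 0 * a 1 * a 2 + a 0 * a 1 * a 3 + a 0 * a 2 * a 3 + a 1 * a 2 * a 3"

lemma three_body_tensor_vec:
  assumes "\<And>k. A *v f k = complex_of_real (a k) *s f k"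
  shows "three_body A *v tensor_vec f = complex_of_real (esym3 a) *s tensor_vec f"
  by (simp add: three_body_expand matrix_vector_mult_add_rdistrib local_op_tensor_vec[OF assms]
      vector_scalar_commute esym3_def vec_eq_iff algebra_simps flip: matrix_vector_mul_assoc)

text \<open>The left-eigenvector form used by \<open>fisher_info_le\<close>. Hermitian local factors
  move to the left one at a time; the reversal of their order is harmless, as each only multiplies
  the product vector by a scalar.\<close>

lemma cinner_three_body:
  assumes "hermitian A" and f: "\<And>k. A *v f k = complex_of_real (a k) *s f k"
  shows "cinner (tensor_vec f) (three_body A *v \<psi>) = complex_of_real (esym3 a) * cinner (tensor_vec f) \<psi>"
  by (simp add: three_body_expand matrix_vector_mult_add_rdistrib cinner_add_right
      hermitian_cinner[OF hermitian_local_op[OF assms(1)]] local_op_tensor_vec[OF f]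
      vector_scalar_commute cinner_scale_left esym3_def algebra_simps flip: matrix_vector_mul_assoc)

text \<open>The common core of all cases: if \<open>a\<close> and \<open>b\<close> are extremal for
  \<open>esym3\<close> on the cube, the upper bound and the value at the superposition are both
  \<open>(esym3 a - esym3 b)\<^sup>2\<close>.\<close>

lemma three_body_maximized:
  fixes H :: "complex ^ 'n ^ 'n::finite"
  assumes H: "hermitian H"
    and spectrum: "\<And>c. eigenvalue H (complex_of_real c) \<Longrightarrow> m \<le> c \<and> c \<le> M"
    and f: "\<And>k. H *v f k = complex_of_real (a k) *s f k" "\<And>k. norm (f k) = 1"
    and g: "\<And>k. H *v g k = complex_of_real (b k) *s g k" "\<And>k. norm (g k) = 1"
    and "a k \<noteq> b k"
    and extremal: "\<And>c. (\<And>k. m \<le> c k \<and> c k \<le> M) \<Longrightarrow> esym3 b \<le> esym3 c \<and> esym3 c \<le> esym3 a"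
  shows "maximized_by (fisher_info (three_body H)) ((tensor_vec f + tensor_vec g) /\<^sub>R sqrt 2)"
proof -
  obtain B where B: "finite B" "orthonormal_eigenvectors H B"
    and resolution: "\<And>i j. (\<Sum>b\<in>B. b $ i * cnj (b $ j)) = of_bool (i = j)"
    using hermitian_eigenbasis[OF H] by blast
  obtain e where e: "\<And>b. b \<in> B \<Longrightarrow> H *v b = complex_of_real (e b) *s b"
    using B(2) unfolding orthonormal_eigenvectors_def by metis
  have e_bounds: "m \<le> e b \<and> e b \<le> M" if "b \<in> B" for b
  proof -
    have "norm b = 1" using B(2) that by (simp add: orthonormal_eigenvectors_def)
    then have "b \<noteq> 0" by auto
    then show ?thesis
      using e[OF that] by (intro spectrum) (auto simp: eigenvalue_def eigenvector_def)
  qed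
  have upper: "fisher_info (three_body H) \<psi> \<le> (esym3 a - esym3 b)\<^sup>2" if "norm \<psi> = 1" for \<psi>
  proof (rule fisher_info_le[where X = "UNIV \<rightarrow>\<^sub>E B" and u = tensor_vec and a = "\<lambda>x. esym3 (\<lambda>k. e (x k))"])
    show "cinner (tensor_vec x) (three_body H *v \<phi>) =
        complex_of_real (esym3 (\<lambda>k. e (x k))) * cinner (tensor_vec x) \<phi>" if "x \<in> UNIV \<rightarrow>\<^sub>E B" for x \<phi>
      using that by (intro cinner_three_body H e) auto
    show "esym3 b \<le> esym3 (\<lambda>k. e (x k)) \<and> esym3 (\<lambda>k. e (x k)) \<le> esym3 a" if "x \<in> UNIV \<rightarrow>\<^sub>E B" for x
      using that by (intro extremal e_bounds) auto
    show "(\<Sum>x\<in>UNIV \<rightarrow>\<^sub>E B. tensor_vec x $ i * cnj (tensor_vec x $ j)) = of_bool (i = j)"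
      for i j :: "4 \<Rightarrow> 'n"
      by (rule tensor_resolution[OF B(1) resolution])
  qed (rule that)
  \<comment> \<open>One orthogonal pair of factors makes the whole product vectors
    orthogonal.\<close>
  have "cinner (f k) (g k) = 0"
    using eigenvectors_orthogonal[OF H f(1) g(1) \<open>a k \<noteq> b k\<close>] .
  then have "cinner (tensor_vec f) (tensor_vec g) = 0"
    by (auto simp: cinner_tensor_vec)
  note s = norm_tensor_vec[OF f(2)] norm_tensor_vec[OF g(2)] this
    three_body_tensor_vec[OF f(1)] three_body_tensor_vec[OF g(1)]
  show ?thesis
    unfolding maximized_by_def is_arg_max_def
    using norm_superposition[OF s] fisher_info_superposition[OF s] upper by (auto simp: not_less)
qed

section \<open>Extrema of the third elementary symmetric polynomial\<close>

lemma affine_le: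
  fixes p q x :: real
  assumes "m \<le> x" "x \<le> M" "p + q * m \<le> K" "p + q * M \<le> K"
  shows "p + q * x \<le> K"
proof (cases "0 \<le> q")
  case True
  then show ?thesis using mult_left_mono[OF assms(2) True] assms(4) by linarith
next
  case False
  then show ?thesis using mult_left_mono_neg[OF assms(1), of q] assms(3) by linarith
qed

text \<open>By affineness in each variable a vertex of the cube is maximal, and by symmetry only the
  number of coordinates equal to \<open>M\<close> matters. The five bounds treat 4, 3, 2, 1 and 0
  such coordinates.\<close>

lemma esym3_le_vertices:
  assumes c: "\<And>k. m \<le> c k \<and> c k \<le> M"
    and K: "4 * M ^ 3 \<le> K" "M ^ 3 + 3 * M\<^sup>2 * m \<le> K" "2 * M\<^sup>2 * m + 2 * M * m\<^sup>2 \<le> K"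
      "3 * M * m\<^sup>2 + m ^ 3 \<le> K" "4 * m ^ 3 \<le> K"
  shows "esym3 c \<le> K"
proof -
  define e where "e x y z w = x * y * z + x * y * w + x * z * w + y * z * w" for x y z w :: real
  have w: "e x y z w \<le> K" if "m \<le> w" "w \<le> M" "e x y z m \<le> K" "e x y z M \<le> K" for x y z w
    using affine_le[OF that(1,2), of "x * y * z" "x * y + x * z + y * z" K] that(3,4)
    by (simp add: e_def algebra_simps)
  \<comment> \<open>Rotation brings each coordinate in turn to the last place, where
    \<open>w\<close> replaces an endpoint by a value \<open>c k\<close>. Facts 0 to 3 free one more
    coordinate each.\<close>
  have sym: "e x y z w = e w x y z" for x y z w
    by (simp add: e_def algebra_simps)
  have 0: "e x y z w \<le> K" if "x \<in> {m, M}" "y \<in> {m, M}" "z \<in> {m, M}" "w \<in> {m, M}" for x y z w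
    using that K
    by (auto simp: e_def power2_eq_square power3_eq_cube algebra_simps)
  have c: "m \<le> c k" "c k \<le> M" for k using c by simp_all
  have 1: "e x y z (c 0) \<le> K" if "x \<in> {m, M}" "y \<in> {m, M}" "z \<in> {m, M}" for x y z
    by (rule w[OF c]; rule 0) (use that in simp_all)
  have 2: "e (c 0) x y (c 1) \<le> K" if "x \<in> {m, M}" "y \<in> {m, M}" for x y
    by (rule w[OF c]; subst sym[symmetric], rule 1) (use that in simp_all)
  have 3: "e (c 1) (c 0) x (c 2) \<le> K" if "x \<in> {m, M}" for x
    by (rule w[OF c]; subst sym[symmetric], rule 2) (use that in simp_all)
  have "e (c 2) (c 1) (c 0) (c 3) \<le> K"
    by (rule w[OF c]; subst sym[symmetric], rule 3) simp_all
  then show ?thesis by (simp add: e_def esym3_def algebra_simps)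
qed

text \<open>Odd degree: negating the variables exchanges the roles of \<open>m\<close> and
  \<open>M\<close> and turns upper bounds into lower ones.\<close>

lemma esym3_minus: "esym3 (\<lambda>k. - c k) = - esym3 c"
  by (simp add: esym3_def)

text \<open>\<open>4 * M ^ 3\<close> exceeds the other vertex values by
  \<open>3 * M\<^sup>2 * (M - m)\<close>, \<open>2 * M * (M - m) * (2 * M + m)\<close>,
  \<open>(M - m) * (2 * M + m)\<^sup>2\<close> and \<open>4 * (M ^ 3 - m ^ 3)\<close>. Only the
  second can be negative, whence the sign hypothesis.\<close>

lemma esym3_le_top:
  assumes "\<And>k. m \<le> c k \<and> c k \<le> M" and "0 \<le> M * (2 * M + m)"
  shows "esym3 c \<le> 4 * M ^ 3"
proof (rule esym3_le_vertices[OF assms(1)])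
  have mM: "0 \<le> M - m" using assms(1)[of 0] by linarith
  show "M ^ 3 + 3 * M\<^sup>2 * m \<le> 4 * M ^ 3"
    using mult_nonneg_nonneg[OF mM zero_le_power2[of M]]
    by (simp add: power2_eq_square power3_eq_cube algebra_simps)
  show "2 * M\<^sup>2 * m + 2 * M * m\<^sup>2 \<le> 4 * M ^ 3"
    using mult_nonneg_nonneg[OF mM assms(2)]
    by (simp add: power2_eq_square power3_eq_cube algebra_simps)
  show "3 * M * m\<^sup>2 + m ^ 3 \<le> 4 * M ^ 3"
    using mult_nonneg_nonneg[OF mM zero_le_power2[of "2 * M + m"]]
    by (simp add: power2_eq_square power3_eq_cube algebra_simps)
  show "4 * m ^ 3 \<le> 4 * M ^ 3"
    using mM by (simp add: power_mono_odd)
qed simp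

lemma esym3_ge_bottom:
  assumes "\<And>k. m \<le> c k \<and> c k \<le> M" and "0 \<le> m * (2 * m + M)"
  shows "4 * m ^ 3 \<le> esym3 c"
  using esym3_le_top[of "- M" "\<lambda>k. - c k" "- m"] assms by (simp add: esym3_minus algebra_simps)

text \<open>Beyond the threshold \<open>2 * M + m = 0\<close> the top is overtaken by the vertex
  with two coordinates at each end. Its margins over the vertices with 4, 3 and 1 coordinates
  \<open>M\<close> are products of nonnegative factors; \<open>4 * m ^ 3\<close> is compared through
  \<open>4 * M ^ 3\<close>.\<close>

lemma esym3_le_middle:
  assumes "\<And>k. m \<le> c k \<and> c k \<le> M" and "0 \<le> M" "2 * M + m \<le> 0"
  shows "esym3 c \<le> 2 * M\<^sup>2 * m + 2 * M * m\<^sup>2"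
proof (rule esym3_le_vertices[OF assms(1)])
  have mM: "0 \<le> M - m" and m: "m \<le> 0" and s: "0 \<le> - 2 * M - m"
    using assms(1)[of 0] assms(2,3) by linarith+
  have *: "0 \<le> (M - m) * (- 2 * M - m) * M" "0 \<le> (M - m) * (- 2 * M - m) * (- m)"
    using mM s m assms(2) by (intro mult_nonneg_nonneg; linarith)+
  have cubes: "m ^ 3 \<le> M ^ 3" and mm: "0 \<le> (M - m) * m\<^sup>2"
    using mM by (simp_all add: power_mono_odd)
  show 1: "4 * M ^ 3 \<le> 2 * M\<^sup>2 * m + 2 * M * m\<^sup>2"
    using *(1) by (simp add: power2_eq_square power3_eq_cube algebra_simps)
  have "0 \<le> (M - m) * (- M - 2 * m) * M"
    using mM s m assms(2) by (intro mult_nonneg_nonneg; linarith)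
  then show "M ^ 3 + 3 * M\<^sup>2 * m \<le> 2 * M\<^sup>2 * m + 2 * M * m\<^sup>2"
    by (simp add: power2_eq_square power3_eq_cube algebra_simps)
  show "3 * M * m\<^sup>2 + m ^ 3 \<le> 2 * M\<^sup>2 * m + 2 * M * m\<^sup>2"
    using *(2) by (simp add: power2_eq_square power3_eq_cube algebra_simps)
  show "4 * m ^ 3 \<le> 2 * M\<^sup>2 * m + 2 * M * m\<^sup>2"
    using 1 cubes by linarith
qed simp

lemma esym3_ge_middle:
  assumes "\<And>k. m \<le> c k \<and> c k \<le> M" and "m \<le> 0" "0 \<le> 2 * m + M"
  shows "2 * M\<^sup>2 * m + 2 * M * m\<^sup>2 \<le> esym3 c"
  using esym3_le_middle[of "- M" "\<lambda>k. - c k" "- m"] assms by (simp add: esym3_minus algebra_simps)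

section \<open>Entanglement\<close>

definition local_product :: "'p set \<Rightarrow> complex ^ 'n \<Rightarrow> ('p::finite \<Rightarrow> 'n::finite) \<Rightarrow> complex" where
  "local_product S u a = (\<Prod>k\<in>S. u $ a k)"

text \<open>For nonempty \<open>S\<close> this makes the products of orthonormal vectors
  orthonormal; for empty \<open>S\<close> the exponent 0 would give overlap 1.\<close>

lemma sum_local_product:
  "(\<Sum>a\<in>local_basis S. cnj (local_product S u a) * local_product S v a) = cinner u v ^ card S"
  using prod_sum_PiE[of S "\<lambda>_. UNIV" "\<lambda>_ i. cnj (u $ i) * v $ i"]
  by (simp add: local_basis_def local_product_def cinner_def prod.distrib)

lemma tensor_pow_glue:
  "tensor_pow u $ (\<lambda>k. if k \<in> S then a k else c k) = local_product S u a * local_product (- S) u c"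
proof -
  let ?f = "\<lambda>k. u $ (if k \<in> S then a k else c k)"
  have "prod ?f (S \<union> - S) = prod ?f S * prod ?f (- S)"
    by (rule prod.union_disjoint) auto
  then show ?thesis by (simp add: tensor_pow_def local_product_def Compl_partition)
qed

lemma scaleR_half: "(z :: complex) /\<^sub>R sqrt 2 /\<^sub>R sqrt 2 = z / 2"
  by (simp add: complex_eq_iff field_simps)

text \<open>The cross terms carry overlaps of the two product vectors on the nonempty complement,
  which vanish, so tracing out leaves an equal mixture.\<close>

lemma reduced_density_superposition:
  fixes u v :: "complex ^ 'n::finite" and S :: "'p::finite set"
  assumes "norm u = 1" "norm v = 1" "cinner u v = 0" "S \<noteq> UNIV"
  shows "reduced_density ((tensor_pow u + tensor_pow v) /\<^sub>R sqrt 2) S a b =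
    (local_product S u a * cnj (local_product S u b) +
     local_product S v a * cnj (local_product S v b)) / 2"
proof -
  let ?g = "local_product S" and ?h = "local_product (- S)"
  define ip where "ip w z = (\<Sum>c\<in>local_basis (- S). cnj (?h w c) * ?h z c)"
    for w z :: "complex ^ 'n"
  have "card (- S) > 0" using \<open>S \<noteq> UNIV\<close> by (auto simp: card_gt_0_iff)
  then have ip: "ip u u = 1" "ip v v = 1" "ip u v = 0" "ip v u = 0"
    using assms cinner_commute[of v u]
    by (simp_all add: ip_def sum_local_product iffD2[OF cinner_self_eq_1_iff])
  have "reduced_density ((tensor_pow u + tensor_pow v) /\<^sub>R sqrt 2) S a b =
      (\<Sum>c\<in>local_basis (- S).
        ((?g u a * ?h u c + ?g v a * ?h v c) * cnj (?g u b * ?h u c + ?g v b * ?h v c)) /\<^sub>R sqrt 2 /\<^sub>R sqrt 2)"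
    unfolding reduced_density_def by (simp add: tensor_pow_glue)
  also have "\<dots> = (\<Sum>c\<in>local_basis (- S).
        (?g u a * ?h u c + ?g v a * ?h v c) * cnj (?g u b * ?h u c + ?g v b * ?h v c)) / 2"
    by (simp only: scaleR_half sum_divide_distrib)
  also have "\<dots> = (\<Sum>c\<in>local_basis (- S).
      ?g u a * cnj (?g u b) * (cnj (?h u c) * ?h u c) + ?g u a * cnj (?g v b) * (cnj (?h v c) * ?h u c) +
      ?g v a * cnj (?g u b) * (cnj (?h u c) * ?h v c) + ?g v a * cnj (?g v b) * (cnj (?h v c) * ?h v c)) / 2"
    by (simp add: algebra_simps)
  also have "\<dots> = (?g u a * cnj (?g u b) * ip u u + ?g u a * cnj (?g v b) * ip v u +
      ?g v a * cnj (?g u b) * ip u v + ?g v a * cnj (?g v b) * ip v v) / 2"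
    by (simp only: ip_def sum_distrib_left sum.distrib)
  finally show ?thesis by (simp add: ip)
qed

text \<open>
  A reduced density matrix \<open>\<rho>\<close> of this state satisfies \<open><u|\<rho>|u> = <v|\<rho>|v> = 1/2\<close> and
  \<open><u|\<rho>|v> = 0\<close> (for the corresponding product vectors). If \<open>\<rho> = |\<phi>><\<phi>|\<close>, the first two equations
  make \<open><u|\<phi>>\<close> and \<open><\<phi>|v>\<close> nonzero, but the third says that their product vanishes.
\<close>

lemma superposition_genuinely_multipartite_entangled:
  fixes u v :: "complex ^ 'n::finite"
  assumes "norm u = 1" "norm v = 1" "cinner u v = 0"
  shows "genuinely_multipartite_entangled
    ((tensor_pow u + tensor_pow v) /\<^sub>R sqrt 2 :: complex ^ ('p::finite \<Rightarrow> 'n))"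
  unfolding genuinely_multipartite_entangled_def
proof (intro allI impI notI)
  fix S :: "'p set"
  let ?\<rho> = "reduced_density ((tensor_pow u + tensor_pow v) /\<^sub>R sqrt 2) S"
  let ?g = "local_product S"
  let ?B = "local_basis S :: ('p \<Rightarrow> 'n) set"
  assume "S \<noteq> {} \<and> S \<noteq> UNIV" and "pure_density S ?\<rho>"
  then obtain \<phi> where S: "S \<noteq> UNIV" "card S > 0"
    and \<phi>: "\<And>a b. a \<in> ?B \<Longrightarrow> b \<in> ?B \<Longrightarrow> ?\<rho> a b = \<phi> a * cnj (\<phi> b)"
    unfolding pure_density_def by (auto simp: card_gt_0_iff)
  define ip where "ip w z = (\<Sum>a\<in>?B. cnj (?g w a) * ?g z a)" for w z
  have ip: "ip u u = 1" "ip v v = 1" "ip u v = 0" "ip v u = 0"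
    using assms S cinner_commute[of v u]
    by (simp_all add: ip_def sum_local_product iffD2[OF cinner_self_eq_1_iff])
  define t where "t w = (\<Sum>a\<in>?B. cnj (?g w a) * \<phi> a)" for w
  \<comment> \<open>The matrix element of \<open>?\<rho>\<close> between the product vectors of
    \<open>w\<close> and \<open>z\<close>, computed once from purity and once from the explicit
    mixture.\<close>
  have elem: "t w * cnj (t z) = (ip w u * ip u z + ip w v * ip v z) / 2" for w z
  proof -
    have "t w * cnj (t z) = (\<Sum>a\<in>?B. \<Sum>b\<in>?B. cnj (?g w a) * ?g z b * (\<phi> a * cnj (\<phi> b)))"
      unfolding t_def cnj_sum sum_product by (simp add: mult_ac)
    also have "\<dots> = (\<Sum>a\<in>?B. \<Sum>b\<in>?B. cnj (?g w a) * ?g z b * ?\<rho> a b)"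
      by (intro sum.cong refl) (simp add: \<phi>)
    also have "\<dots> = (\<Sum>a\<in>?B. \<Sum>b\<in>?B.
        ((cnj (?g w a) * ?g u a) * (cnj (?g u b) * ?g z b) +
         (cnj (?g w a) * ?g v a) * (cnj (?g v b) * ?g z b)) / 2)"
      unfolding reduced_density_superposition[OF assms S(1)]
      by (intro sum.cong refl) (simp add: algebra_simps)
    also have "\<dots> = (ip w u * ip u z + ip w v * ip v z) / 2"
      unfolding ip_def sum_product by (simp only: sum.distrib sum_divide_distrib[symmetric])
    finally show ?thesis .
  qed
  have "t u \<noteq> 0" "t v \<noteq> 0" using elem[of u u] elem[of v v] ip by auto
  moreover have "t u * cnj (t v) = 0" using elem[of u v] ip by simp
  ultimately show False by simp
qed

section \<open>Separability of the product state\<close>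

lemma UNIV_2_zero: "(UNIV :: 2 set) = {0, 1}"
  using UNIV_2 by auto

lemma tensor_pow_2: "tensor_pow u $ (x :: 2 \<Rightarrow> 'n::finite) = u $ x 0 * u $ x 1"
  by (simp add: tensor_pow_def UNIV_2_zero)

lemma product_state_nth:
  "product_state w u v $ x =
    (w $ x 0 * w $ x 1) * ((u $ x 2 * u $ x 3 + v $ x 2 * v $ x 3) /\<^sub>R sqrt 2)"
  by (simp add: product_state_def tensor22_def tensor_pow_2)

text \<open>Across the cut between parties 0, 1 and parties 2, 3 the state is a product. Tracing out
  the unit vector \<open>r\<close> leaves the projector onto the product vector of
  \<open>w\<close>.\<close>

lemma product_state_not_entangled:
  fixes w u v :: "complex ^ 'n::finite"
  assumes w: "norm w = 1" and uv: "norm u = 1" "norm v = 1" "cinner u v = 0"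
  shows "\<not> genuinely_multipartite_entangled (product_state w u v)"
proof -
  let ?S = "{0, 1} :: 4 set"
  let ?\<phi> = "local_product ?S w"
  let ?h = "local_product (- ?S)"
  define r where "r c = (?h u c + ?h v c) /\<^sub>R sqrt 2" for c
  have \<psi>: "product_state w u v $ (\<lambda>k. if k \<in> ?S then a k else c k) = ?\<phi> a * r c" for a c
    by (simp add: product_state_nth r_def local_product_def compl_01_4 neq_4)
  have r: "(\<Sum>c\<in>local_basis (- ?S). r c * cnj (r c)) = 1"
  proof -
    have "(\<Sum>c\<in>local_basis (- ?S). r c * cnj (r c)) =
        (\<Sum>c\<in>local_basis (- ?S). (cnj (?h u c) * ?h u c + cnj (?h u c) * ?h v c +
          cnj (?h v c) * ?h u c + cnj (?h v c) * ?h v c) / 2)"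
    proof (intro sum.cong refl)
      fix c
      have "r c * cnj (r c) = ((?h u c + ?h v c) * cnj (?h u c + ?h v c)) /\<^sub>R sqrt 2 /\<^sub>R sqrt 2"
        by (simp add: r_def)
      also have "\<dots> = ((?h u c + ?h v c) * cnj (?h u c + ?h v c)) / 2"
        by (rule scaleR_half)
      finally show "r c * cnj (r c) = (cnj (?h u c) * ?h u c + cnj (?h u c) * ?h v c +
          cnj (?h v c) * ?h u c + cnj (?h v c) * ?h v c) / 2"
        by (simp add: algebra_simps)
    qed
    also have "\<dots> = (cinner u u ^ 2 + cinner u v ^ 2 + cinner v u ^ 2 + cinner v v ^ 2) / 2"
      by (simp add: sum.distrib sum_local_product compl_01_4 neq_4 power2_eq_square flip: sum_divide_distrib)
    finally show ?thesis
      using uv cinner_commute[of v u] by (simp add: iffD2[OF cinner_self_eq_1_iff])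
  qed
  have "reduced_density (product_state w u v) ?S a b = ?\<phi> a * cnj (?\<phi> b)" for a b
  proof -
    have "?\<phi> a * r c * cnj (?\<phi> b * r c) = ?\<phi> a * cnj (?\<phi> b) * (r c * cnj (r c))" for c
      unfolding complex_cnj_mult by (rule mult.assoc[THEN trans]) (simp add: mult_ac)
    then have "reduced_density (product_state w u v) ?S a b =
        (\<Sum>c\<in>local_basis (- ?S). ?\<phi> a * cnj (?\<phi> b) * (r c * cnj (r c)))"
      unfolding reduced_density_def \<psi> by (rule sum.cong[OF refl])
    then show ?thesis
      unfolding sum_distrib_left[symmetric] r by (rule trans) (rule mult_1_right)
  qed
  moreover have "(\<Sum>a\<in>local_basis ?S. (cmod (?\<phi> a))\<^sup>2) = 1"
  proof -
    have "complex_of_real (\<Sum>a\<in>local_basis ?S. (cmod (?\<phi> a))\<^sup>2) =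
        (\<Sum>a\<in>local_basis ?S. cnj (?\<phi> a) * ?\<phi> a)"
      unfolding of_real_sum by (simp only: complex_norm_square mult.commute)
    also have "\<dots> = 1"
      using w by (simp add: sum_local_product iffD2[OF cinner_self_eq_1_iff])
    finally show ?thesis by (simp only: of_real_eq_1_iff)
  qed
  ultimately have pure: "pure_density ?S (reduced_density (product_state w u v) ?S)"
    unfolding pure_density_def by blast
  have "2 \<notin> ?S" by (simp add: neq_4)
  then have proper: "?S \<noteq> {} \<and> ?S \<noteq> UNIV" by blast
  show ?thesis
  proof
    assume "genuinely_multipartite_entangled (product_state w u v)"
    then have "?S \<noteq> {} \<and> ?S \<noteq> UNIV \<longrightarrow> \<not> pure_density ?S (reduced_density (product_state w u v) ?S)"
      unfolding genuinely_multipartite_entangled_def by (rule spec)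
    then show False using proper pure by (rule mp[THEN notE])
  qed
qed

section \<open>The maximizers\<close>

lemma tensor_pow_conv_tensor_vec: "tensor_pow v = tensor_vec (\<lambda>_. v)"
  by (simp add: tensor_pow_def tensor_vec_def)

text \<open>The form needed by \<open>three_body_maximized\<close>: two product vectors that agree
  on parties 0 and 1.\<close>

lemma product_state_conv_tensor_vec:
  "product_state w u v =
    (tensor_vec (\<lambda>k. if k \<in> {0, 1} then w else u) + tensor_vec (\<lambda>k. if k \<in> {0, 1} then w else v))
      /\<^sub>R sqrt 2"
  by (simp add: vec_eq_iff product_state_nth tensor_vec_def prod_UNIV_4 neq_4 algebra_simps)

theorem mainTheorem10:
  fixes H :: "complex ^ 'n ^ 'n::finite"
    and \<delta>M \<delta>m :: real
    and vM vm :: "complex ^ 'n"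
  assumes "hermitian H"
    and "max_eigenvalue H \<delta>M"
    and "min_eigenvalue H \<delta>m"
    and "\<delta>m < \<delta>M"
    and "eigenvector H vM (complex_of_real \<delta>M)" and "norm vM = 1"
    and "eigenvector H vm (complex_of_real \<delta>m)" and "norm vm = 1"
  shows "((\<delta>M > 0 \<and> \<delta>m > 0) \<or> (\<delta>M < 0 \<and> \<delta>m < 0) \<longrightarrow>
            maximized_by (fisher_info (three_body H)) (ghz_state vM vm)) \<and>
         (\<delta>M > 0 \<and> 0 > \<delta>m \<and> \<bar>\<delta>M\<bar> > \<bar>\<delta>m\<bar> \<longrightarrow>
            (\<bar>\<delta>M\<bar> < 2 * \<bar>\<delta>m\<bar> \<longrightarrow>
               maximized_by (fisher_info (three_body H)) (ghz_state vM vm)) \<and>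
            (\<bar>\<delta>M\<bar> > 2 * \<bar>\<delta>m\<bar> \<longrightarrow>
               maximized_by (fisher_info (three_body H)) (product_state vM vM vm) \<and>
               \<not> genuinely_multipartite_entangled (product_state vM vM vm))) \<and>
         (\<delta>M > 0 \<and> 0 > \<delta>m \<and> \<bar>\<delta>M\<bar> < \<bar>\<delta>m\<bar> \<longrightarrow>
            (\<bar>\<delta>M\<bar> > \<bar>\<delta>m\<bar> / 2 \<longrightarrow>
               maximized_by (fisher_info (three_body H)) (ghz_state vM vm)) \<and>
            (\<bar>\<delta>M\<bar> < \<bar>\<delta>m\<bar> / 2 \<longrightarrow>
               maximized_by (fisher_info (three_body H)) (product_state vm vM vm) \<and>
               \<not> genuinely_multipartite_entangled (product_state vm vM vm))) \<and>
         (\<delta>M > 0 \<and> 0 > \<delta>m \<and> \<bar>\<delta>M\<bar> = \<bar>\<delta>m\<bar> \<longrightarrow>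
            maximized_by (fisher_info (three_body H)) (ghz_state vM vm)) \<and>
         genuinely_multipartite_entangled (ghz_state vM vm)"
proof -
  have spectrum: "\<delta>m \<le> c \<and> c \<le> \<delta>M" if "eigenvalue H (complex_of_real c)" for c
    using assms(2,3) that by (simp add: max_eigenvalue_def min_eigenvalue_def)
  have vM: "H *v vM = complex_of_real \<delta>M *s vM" and vm: "H *v vm = complex_of_real \<delta>m *s vm"
    using assms(5,7) by (simp_all add: eigenvector_def)
  have orth: "cinner vM vm = 0"
    using eigenvectors_orthogonal[OF assms(1) vM vm] assms(4) by simp
  have distinct: "(2::4) \<notin> {0, 1}" "(3::4) \<notin> {0, 1}"
    by (simp_all add: neq_4)
  \<comment> \<open>Exactly the sign conditions under which the all-\<open>\<delta>M\<close> and
    all-\<open>\<delta>m\<close> vertices are extremal.\<close>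
  have ghz: "maximized_by (fisher_info (three_body H)) (ghz_state vM vm)"
    if "0 \<le> \<delta>M * (2 * \<delta>M + \<delta>m)" "0 \<le> \<delta>m * (2 * \<delta>m + \<delta>M)"
    unfolding ghz_state_def tensor_pow_conv_tensor_vec
  proof (rule three_body_maximized[where a = "\<lambda>_. \<delta>M" and b = "\<lambda>_. \<delta>m", OF assms(1) spectrum])
    fix c :: "4 \<Rightarrow> real"
    assume "\<And>k. \<delta>m \<le> c k \<and> c k \<le> \<delta>M"
    then show "esym3 (\<lambda>_. \<delta>m) \<le> esym3 c \<and> esym3 c \<le> esym3 (\<lambda>_. \<delta>M)"
      using esym3_le_top[of \<delta>m c \<delta>M] esym3_ge_bottom[of \<delta>m c \<delta>M] that
      by (simp add: esym3_def power3_eq_cube)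
  qed (use vM vm assms in auto)
  \<comment> \<open>The maximum stays at the top vertex, while the minimum is attained with two
    coordinates at each end.\<close>
  have prod_M: "maximized_by (fisher_info (three_body H)) (product_state vM vM vm)"
    if "0 < \<delta>M" "\<delta>m < 0" "0 \<le> 2 * \<delta>m + \<delta>M"
    unfolding product_state_conv_tensor_vec
  \<comment> \<open>Party 2 is one where the two product vectors differ; the conditional with equal
    branches in \<open>a\<close> mirrors the shape of the first product vector.\<close>
  proof (rule three_body_maximized[where k = 2 and a = "\<lambda>k. if k \<in> {0, 1} then \<delta>M else \<delta>M"
        and b = "\<lambda>k. if k \<in> {0, 1} then \<delta>M else \<delta>m", OF assms(1) spectrum])
    fix c :: "4 \<Rightarrow> real"
    assume c: "\<And>k. \<delta>m \<le> c k \<and> c k \<le> \<delta>M"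
    have "0 \<le> \<delta>M * (2 * \<delta>M + \<delta>m)" using that by simp
    then show "esym3 (\<lambda>k. if k \<in> {0, 1} then \<delta>M else \<delta>m) \<le> esym3 c \<and>
        esym3 c \<le> esym3 (\<lambda>k. if k \<in> {0, 1} then \<delta>M else \<delta>M)"
      using esym3_le_top[of \<delta>m c \<delta>M] esym3_ge_middle[of \<delta>m c \<delta>M] that distinct c
      by (simp add: esym3_def power2_eq_square power3_eq_cube algebra_simps)
  qed (use vM vm assms distinct in auto)
  \<comment> \<open>The mirror image: the minimum stays at the bottom and the maximum is in the
    middle.\<close>
  have prod_m: "maximized_by (fisher_info (three_body H)) (product_state vm vM vm)"
    if "0 < \<delta>M" "\<delta>m < 0" "2 * \<delta>M + \<delta>m \<le> 0"
    unfolding product_state_conv_tensor_vec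
  proof (rule three_body_maximized[where k = 2 and a = "\<lambda>k. if k \<in> {0, 1} then \<delta>m else \<delta>M"
        and b = "\<lambda>k. if k \<in> {0, 1} then \<delta>m else \<delta>m", OF assms(1) spectrum])
    fix c :: "4 \<Rightarrow> real"
    assume c: "\<And>k. \<delta>m \<le> c k \<and> c k \<le> \<delta>M"
    have "0 \<le> \<delta>m * (2 * \<delta>m + \<delta>M)" using that by (intro mult_nonpos_nonpos) auto
    then show "esym3 (\<lambda>k. if k \<in> {0, 1} then \<delta>m else \<delta>m) \<le> esym3 c \<and>
        esym3 c \<le> esym3 (\<lambda>k. if k \<in> {0, 1} then \<delta>m else \<delta>M)"
      using esym3_ge_bottom[of \<delta>m c \<delta>M] esym3_le_middle[of \<delta>m c \<delta>M] that distinct c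
      by (simp add: esym3_def power2_eq_square power3_eq_cube algebra_simps)
  qed (use vM vm assms distinct in auto)
  have ghz_pos: "maximized_by (fisher_info (three_body H)) (ghz_state vM vm)" if "0 < \<delta>m"
    using that assms(4) by (intro ghz) simp_all
  have ghz_neg: "maximized_by (fisher_info (three_body H)) (ghz_state vM vm)" if "\<delta>M < 0"
    using that assms(4) by (intro ghz mult_nonpos_nonpos) simp_all
  \<comment> \<open>This range of ratios covers the GHZ subcases of (2) and (3) and all of
    (4).\<close>
  have ghz_mixed: "maximized_by (fisher_info (three_body H)) (ghz_state vM vm)"
    if "0 < \<delta>M" "\<delta>m < 0" "\<delta>M \<le> - 2 * \<delta>m" "- \<delta>m \<le> 2 * \<delta>M"
    using that by (intro ghz mult_nonneg_nonneg mult_nonpos_nonpos) simp_all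
  have "genuinely_multipartite_entangled (ghz_state vM vm)"
    unfolding ghz_state_def
    by (rule superposition_genuinely_multipartite_entangled[OF assms(6,8) orth])
  then show ?thesis
  \<comment> \<open>Goal 1 is case (1), goals 2 to 4 are case (2), goals 5 to 7 are case (3), and
    goal 8 is case (4); the chained fact settles the final conjunct.\<close>
  proof (intro conjI impI, goal_cases)
    case 1
    then show ?case using ghz_pos ghz_neg by blast
  next
    case 2
    then show ?case by (elim conjE, intro ghz_mixed; arith)
  next
    case 3
    then show ?case by (elim conjE, intro prod_M; arith)
  next
    case 4
    show ?case by (rule product_state_not_entangled[OF assms(6,6,8) orth])
  next
    case 5
    then show ?case by (elim conjE, intro ghz_mixed; arith)
  next
    case 6
    then show ?case by (elim conjE, intro prod_m; arith)
  next
    case 7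
    show ?case by (rule product_state_not_entangled[OF assms(8,6,8) orth])
  next
    case 8
    then show ?case by (elim conjE, intro ghz_mixed; arith)
  qed
qed

end
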